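(* For every separable metrizable space $M$, $\mathcal{K}(M) \not\ge_T \Sigma(\omega^{\omega_1})$.
   Context: All posets are directed. For posets $P,Q$, $P \ge_T Q$ ($Q$ is a Tukey quotient of $P$) means that there is a map $\phi: P \to Q$ taking every cofinal subset of $P$ to a cofinal subset of $Q$. For a space $X$, $\mathcal{K}(X)$ is the set of all compact subsets of $X$ ordered by inclusion. $\Sigma(\omega^{\omega_1})$ is the set of all functions $\omega_1 \to \omega$ that are eventually constantly equal to $0$, ordered pointwise. *)

theory Defs
  imports "HOL-Analysis.Analysis" "HOL-Library.Countable_Set_Type"
begin

text \<open>
  Posets are subsets of a type of class \<open>order\<close>, with the order of that type restricted to them:
  inclusion on \<open>'a set\<close>, the pointwise order on functions. The constant \<open>cofinal\<close> of the
  library asks for strict upper bounds, hence a separate notion here.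
\<close>

definition directed_poset :: "'a::order set \<Rightarrow> bool" where
  "directed_poset P \<longleftrightarrow> P \<noteq> {} \<and> (\<forall>x\<in>P. \<forall>y\<in>P. \<exists>z\<in>P. x \<le> z \<and> y \<le> z)"

definition cofinal_subset :: "'a::order set \<Rightarrow> 'a set \<Rightarrow> bool" where
  "cofinal_subset P C \<longleftrightarrow> C \<subseteq> P \<and> (\<forall>x\<in>P. \<exists>c\<in>C. x \<le> c)"

definition tukey_ge :: "'a::order set \<Rightarrow> 'b::order set \<Rightarrow> bool"  (infix \<open>\<ge>\<^sub>T\<close> 50) where
  "P \<ge>\<^sub>T Q \<longleftrightarrow>
     (\<exists>\<phi>. \<phi> \<in> P \<rightarrow> Q \<and> (\<forall>C. cofinal_subset P C \<longrightarrow> cofinal_subset Q (\<phi> ` C)))"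

definition compact_subsets :: "'a topology \<Rightarrow> 'a set set" where
  "compact_subsets X = {K. compactin X K}"

lemma directed_compact_subsets: "directed_poset (compact_subsets X)"
  unfolding directed_poset_def compact_subsets_def
  using compactin_empty compactin_Un by blast

text \<open>The ordinal \<open>\<omega>\<^sub>1\<close> as a type: the field of the successor cardinal of \<open>\<omega>\<close>, with its well-order.\<close>

lemma Card_order_cardSuc_natLeq: "Card_order (cardSuc natLeq)"
  by (rule cardSuc_Card_order[OF natLeq_Card_order])

lemma infinite_Field_cardSuc_natLeq: "infinite (Field (cardSuc natLeq))"
  using cardSuc_finite[OF natLeq_Card_order] by (simp add: Field_natLeq)

typedef omega1 = "Field (cardSuc natLeq)"
  using infinite_imp_nonempty[OF infinite_Field_cardSuc_natLeq] by blast

instantiation omega1 :: wellorder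
begin

definition less_eq_omega1 :: "omega1 \<Rightarrow> omega1 \<Rightarrow> bool" where
  "\<alpha> \<le> \<beta> \<longleftrightarrow> (Rep_omega1 \<alpha>, Rep_omega1 \<beta>) \<in> cardSuc natLeq"

definition less_omega1 :: "omega1 \<Rightarrow> omega1 \<Rightarrow> bool" where
  "\<alpha> < \<beta> \<longleftrightarrow> \<alpha> \<le> \<beta> \<and> \<alpha> \<noteq> (\<beta>::omega1)"

instance
proof -
  let ?r = "cardSuc natLeq"
  have wo: "Well_order ?r"
    using Card_order_cardSuc_natLeq card_order_on_well_order_on by blast
  then have lin: "Linear_order ?r" and wf: "wf (?r - Id)"
    by (auto simp: well_order_on_def)
  have r: "refl_on (Field ?r) ?r" and t: "trans ?r" and a: "antisym ?r" and tot: "total_on (Field ?r) ?r"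
    using lin by (auto simp: order_on_defs)
  show "OFCLASS(omega1, wellorder_class)"
  proof
    fix x y z :: omega1
    show "x \<le> x"
      using r Rep_omega1 by (auto simp: less_eq_omega1_def refl_on_def)
    show "x \<le> y \<Longrightarrow> y \<le> z \<Longrightarrow> x \<le> z"
      using t unfolding less_eq_omega1_def by (blast dest: transD)
    show anti: "x \<le> y \<Longrightarrow> y \<le> x \<Longrightarrow> x = y"
      using a unfolding less_eq_omega1_def by (metis Rep_omega1_inject antisymD)
    show "x < y \<longleftrightarrow> x \<le> y \<and> \<not> y \<le> x"
      using anti \<open>x \<le> x\<close> by (auto simp: less_omega1_def less_eq_omega1_def Rep_omega1_inject dest: antisymD[OF a])
    show "x \<le> y \<or> y \<le> x"
      using tot Rep_omega1 \<open>x \<le> x\<close> unfolding less_eq_omega1_def total_on_def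
      by (metis Rep_omega1_inject)
  next
    fix P :: "omega1 \<Rightarrow> bool" and a
    assume step: "\<And>x. (\<And>y. y < x \<Longrightarrow> P y) \<Longrightarrow> P x"
    have "wf (inv_image (?r - Id) Rep_omega1)"
      using wf by (rule wf_inv_image)
    then show "P a"
    proof (induction a rule: wf_induct_rule)
      case (less x)
      show ?case
        by (rule step, rule less)
          (auto simp: less_omega1_def less_eq_omega1_def Rep_omega1_inject)
    qed
  qed
qed

end

text \<open>Uncountable with countable proper initial segments, i.e.\ of order type \<open>\<omega>\<^sub>1\<close>.\<close>

context
  includes cardinal_syntax
begin

lemma uncountable_omega1: "uncountable (UNIV :: omega1 set)"
proof
  assume "countable (UNIV :: omega1 set)"
  then have "countable (Field (cardSuc natLeq))"
    using countable_image[of UNIV Rep_omega1] by (simp add: type_definition.Rep_range[OF type_definition_omega1])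
  then have "|Field (cardSuc natLeq)| \<le>o natLeq"
    using countable_card_le_natLeq by blast
  then have "cardSuc natLeq \<le>o natLeq"
    by (meson Card_order_cardSuc_natLeq card_of_Field_ordIso ordIso_ordLeq_trans ordIso_symmetric)
  then show False
    using cardSuc_greater[OF natLeq_Card_order] not_ordLess_ordLeq by blast
qed

lemma countable_lessThan_omega1: "countable {..<\<alpha>::omega1}"
proof -
  let ?U = "underS (cardSuc natLeq) (Rep_omega1 \<alpha>)"
  have "|?U| <o cardSuc natLeq"
    using card_of_underS[OF Card_order_cardSuc_natLeq Rep_omega1] .
  then have "|?U| \<le>o natLeq"
    using cardSuc_ordLeq_ordLess[OF natLeq_Card_order card_of_Card_order] by blast
  then have "countable ?U"
    using countable_card_le_natLeq by blast
  moreover have "Rep_omega1 ` {..<\<alpha>} \<subseteq> ?U"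
    by (auto simp: underS_def less_omega1_def less_eq_omega1_def Rep_omega1_inject)
  ultimately have "countable (Rep_omega1 ` {..<\<alpha>})"
    using countable_subset by blast
  then show ?thesis
    by (rule countable_image_inj_on) (simp add: inj_on_def Rep_omega1_inject)
qed

end

definition Sigma_omega1 :: "(omega1 \<Rightarrow> nat) set" where
  "Sigma_omega1 = {f. \<exists>\<alpha>. \<forall>\<beta>\<ge>\<alpha>. f \<beta> = 0}"

lemma directed_Sigma_omega1: "directed_poset Sigma_omega1"
  unfolding directed_poset_def
proof (intro conjI ballI)
  show "Sigma_omega1 \<noteq> {}"
    by (auto simp: Sigma_omega1_def intro: exI[of _ "\<lambda>_. 0"])
next
  fix f g assume "f \<in> Sigma_omega1" "g \<in> Sigma_omega1"
  then obtain a b where "\<forall>\<beta>\<ge>a. f \<beta> = 0" "\<forall>\<beta>\<ge>b. g \<beta> = 0"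
    by (auto simp: Sigma_omega1_def)
  then have "sup f g \<in> Sigma_omega1"
    unfolding Sigma_omega1_def by (intro CollectI exI[of _ "max a b"]) auto
  then show "\<exists>h\<in>Sigma_omega1. f \<le> h \<and> g \<le> h"
    by (intro bexI[of _ "sup f g"]) auto
qed

end

theory Submission
  imports Defs
begin

text \<open>
  A Tukey quotient map yields \<open>\<psi>\<close> from \<open>\<Sigma>(\<omega>\<^bsup>\<omega>\<^sub>1\<^esup>)\<close> to the compact sets such that the preimage of the
  compact subsets of a fixed compact set is bounded. As \<open>M\<close> has a countable family \<open>W\<close> of open sets
  containing a neighbourhood base at every compact set, and a sequence of compact sets shrinking to
  a compact set has compact union with it, each coordinate \<open>f(\<beta>)\<close> is bounded on
  \<open>{f. \<psi> f \<subseteq> W n}\<close> for some \<open>W n\<close> around any given compact set.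
  Apply this to functions \<open>f\<^sub>\<alpha>\<close> which embed \<open>{..<\<alpha>}\<close> into \<open>\<omega>\<close> and vanish from \<open>\<alpha>\<close> on: it covers
  \<open>\<omega>\<^sub>1 \<times> \<omega>\<^sub>1\<close> by countably many rectangles \<open>A \<times> B\<close>, on each of which \<open>f\<^sub>\<alpha>(\<beta>)\<close> is bounded. By
  injectivity \<open>B\<close> is finite whenever \<open>A\<close> is uncountable, so there are not enough rectangles.
\<close>

text \<open>If no choice of \<open>\<psi> q\<close> worked for some \<open>q\<close>, the
  \<open>p\<close> with \<open>\<not> q \<le> \<phi> p\<close> would form a cofinal subset of
  \<open>P\<close>; its image would be cofinal in \<open>Q\<close> without any element above
  \<open>q\<close>.\<close>

lemma tukey_ge_imp_bounded_preimages:
  assumes "P \<ge>\<^sub>T Q"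
  obtains \<psi> \<phi> where "\<And>q. q \<in> Q \<Longrightarrow> \<psi> q \<in> P"
    and "\<And>q p. q \<in> Q \<Longrightarrow> p \<in> P \<Longrightarrow> \<psi> q \<le> p \<Longrightarrow> q \<le> \<phi> p"
proof -
  obtain \<phi> where \<phi>: "\<And>C. cofinal_subset P C \<Longrightarrow> cofinal_subset Q (\<phi> ` C)"
    using assms unfolding tukey_ge_def by blast
  have "\<exists>p\<in>P. \<forall>p'\<in>P. p \<le> p' \<longrightarrow> q \<le> \<phi> p'" if "q \<in> Q" for q
  proof (rule ccontr)
    assume "\<not> ?thesis"
    then have "cofinal_subset P {p \<in> P. \<not> q \<le> \<phi> p}"
      unfolding cofinal_subset_def by blast
    from \<phi>[OF this] show False
      using that unfolding cofinal_subset_def by blast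
  qed
  then show ?thesis
    using that by metis
qed

lemma separable_metrizable_imp_second_countable:
  assumes "metrizable_space X" and "separable_space X"
  shows "second_countable X"
proof -
  obtain S d where "Metric_space S d" and X: "X = Metric_space.mtopology S d"
    using assms(1) unfolding metrizable_space_def by blast
  then interpret Metric_space S d
    by simp
  obtain D where D: "countable D" "D \<subseteq> S" "mtopology closure_of D = S"
    using assms(2) unfolding separable_space_def X by auto
  define \<B> where "\<B> = (\<lambda>(c, n). mball c (1 / real (Suc n))) ` (D \<times> UNIV)"
  have "\<exists>V\<in>\<B>. x \<in> V \<and> V \<subseteq> U" if U: "openin mtopology U" and x: "x \<in> U" for U x
  proof -
    obtain r where r: "r > 0" "mball x r \<subseteq> U" and "x \<in> S"
      using U x unfolding openin_mtopology by blast
    \<comment> \<open>Half of \<open>r\<close>, since the radius is spent twice: on the distance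
      from \<open>x\<close> to a centre \<open>c\<close> in \<open>D\<close>, and on the ball about
      \<open>c\<close>.\<close>
    obtain n where n: "1 / real (Suc n) < r / 2"
      using r(1) nat_approx_posE[of "r / 2"] by auto
    have "1 / real (Suc n) > 0"
      by simp
    moreover have "x \<in> mtopology closure_of D"
      using D(3) \<open>x \<in> S\<close> by simp
    ultimately obtain c where c: "c \<in> D" "c \<in> mball x (1 / real (Suc n))"
      unfolding metric_closure_of by blast
    have "x \<in> mball c (1 / real (Suc n))"
      using c(2) by (simp add: commute)
    moreover have "mball c (1 / real (Suc n)) \<subseteq> mball x r"
    proof (rule mball_subset)
      show "d c x + 1 / real (Suc n) \<le> r"
        using c(2) n by (simp add: commute del: of_nat_Suc)
    qed (fact \<open>x \<in> S\<close>)
    ultimately show ?thesis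
      using r(2) c(1) by (intro bexI[of _ "mball c (1 / real (Suc n))"]) (auto simp: \<B>_def)
  qed
  moreover have "countable \<B>" and "\<And>V. V \<in> \<B> \<Longrightarrow> openin mtopology V"
    using D(1) by (auto simp: \<B>_def)
  ultimately show ?thesis
    unfolding second_countable_def X by blast
qed

text \<open>Finite unions of basic open sets suffice: the basic sets inside \<open>U\<close> cover
  \<open>K\<close>, and finitely many of them already do.\<close>

lemma second_countable_compact_neighbourhoods:
  assumes "second_countable X"
  obtains W :: "nat \<Rightarrow> 'a set" where "\<And>n. openin X (W n)"
    and "\<And>K U. compactin X K \<Longrightarrow> openin X U \<Longrightarrow> K \<subseteq> U \<Longrightarrow> \<exists>n. K \<subseteq> W n \<and> W n \<subseteq> U"
proof -
  obtain \<B> where \<B>: "countable \<B>" "\<And>V. V \<in> \<B> \<Longrightarrow> openin X V"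
    and base: "\<And>U x. openin X U \<Longrightarrow> x \<in> U \<Longrightarrow> \<exists>V\<in>\<B>. x \<in> V \<and> V \<subseteq> U"
    using assms unfolding second_countable_def by metis
  define \<W> where "\<W> = Union ` {\<F>. finite \<F> \<and> \<F> \<subseteq> \<B>}"
  have countable: "countable \<W>" and nonempty: "\<W> \<noteq> {}"
    using countable_Collect_finite_subset[OF \<B>(1)] by (auto simp: \<W>_def)
  show ?thesis
  proof
    fix n
    have "from_nat_into \<W> n \<in> \<W>"
      using nonempty by (rule from_nat_into)
    then obtain \<F> where "\<F> \<subseteq> \<B>" "from_nat_into \<W> n = \<Union>\<F>"
      unfolding \<W>_def by auto
    then show "openin X (from_nat_into \<W> n)"
      using \<B>(2) by (auto intro!: openin_Union)
  next
    fix K U assume K: "compactin X K" and U: "openin X U" "K \<subseteq> U"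
    have "K \<subseteq> \<Union>{V \<in> \<B>. V \<subseteq> U}"
      using base[OF U(1)] U(2) by blast
    then obtain \<F> where \<F>: "finite \<F>" "\<F> \<subseteq> {V \<in> \<B>. V \<subseteq> U}" "K \<subseteq> \<Union>\<F>"
      using compactinD[OF K, of "{V \<in> \<B>. V \<subseteq> U}"] \<B>(2) by blast
    then have "\<Union>\<F> \<in> \<W>"
      by (auto simp: \<W>_def)
    then obtain n where "from_nat_into \<W> n = \<Union>\<F>"
      using from_nat_into_surj[OF countable] by blast
    then show "\<exists>n. K \<subseteq> from_nat_into \<W> n \<and> from_nat_into \<W> n \<subseteq> U"
      using \<F> by (intro exI[of _ n]) auto
  qed
qed

text \<open>A finite subcover of \<open>K\<close> also contains all but finitely many of the
  \<open>L n\<close>, and the remaining ones have a compact union.\<close>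

lemma compactin_Un_UN_shrinking:
  assumes K: "compactin X K" and L: "\<And>n::nat. compactin X (L n)"
    and shrinking: "\<And>U. openin X U \<Longrightarrow> K \<subseteq> U \<Longrightarrow> eventually (\<lambda>n. L n \<subseteq> U) sequentially"
  shows "compactin X (K \<union> (\<Union>n. L n))"
  unfolding compactin_def
proof (intro conjI allI impI)
  show "K \<union> (\<Union>n. L n) \<subseteq> topspace X"
    using K L by (auto dest: compactin_subset_topspace)
next
  fix \<U> assume \<U>: "Ball \<U> (openin X) \<and> K \<union> (\<Union>n. L n) \<subseteq> \<Union>\<U>"
  then obtain \<F> where \<F>: "finite \<F>" "\<F> \<subseteq> \<U>" "K \<subseteq> \<Union>\<F>"
    using compactinD[OF K, of \<U>] by blast
  have "openin X (\<Union>\<F>)"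
    using \<U> \<F>(2) by (intro openin_Union) blast
  from shrinking[OF this \<F>(3)] obtain N where N: "\<And>n. n \<ge> N \<Longrightarrow> L n \<subseteq> \<Union>\<F>"
    unfolding eventually_sequentially by blast
  have "compactin X (\<Union>n<N. L n)"
    using L by (intro compactin_Union) auto
  then obtain \<G> where \<G>: "finite \<G>" "\<G> \<subseteq> \<U>" "(\<Union>n<N. L n) \<subseteq> \<Union>\<G>"
    using compactinD[of X "\<Union>n<N. L n" \<U>] \<U> by blast
  have "L n \<subseteq> \<Union>(\<F> \<union> \<G>)" for n
    using N[of n] \<G>(3) by (cases "n < N") auto
  then have "K \<union> (\<Union>n. L n) \<subseteq> \<Union>(\<F> \<union> \<G>)"
    using \<F>(3) by blast
  then show "\<exists>\<F>. finite \<F> \<and> \<F> \<subseteq> \<U> \<and> K \<union> (\<Union>n. L n) \<subseteq> \<Union>\<F>"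
    using \<F>(1,2) \<G>(1,2) by (intro exI[of _ "\<F> \<union> \<G>"]) auto
qed

text \<open>By diagonalisation: otherwise there are \<open>a n\<close> with
  \<open>g (a n) > n\<close> whose sets \<open>\<psi> (a n)\<close> shrink to \<open>K\<close>. All
  of them lie in one compact set, on whose subsets \<open>g\<close> is bounded.\<close>

lemma locally_bounded_at_compact:
  fixes W :: "nat \<Rightarrow> 'a set" and g :: "'b \<Rightarrow> nat"
  assumes W: "\<And>n. openin X (W n)"
    and nbhd: "\<And>U. openin X U \<Longrightarrow> K \<subseteq> U \<Longrightarrow> \<exists>n. K \<subseteq> W n \<and> W n \<subseteq> U"
    and K: "compactin X K" and \<psi>: "\<And>a. compactin X (\<psi> a)"
    and bounded: "\<And>L. compactin X L \<Longrightarrow> \<exists>m. \<forall>a. \<psi> a \<subseteq> L \<longrightarrow> g a \<le> m"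
  shows "\<exists>n m. K \<subseteq> W n \<and> (\<forall>a. \<psi> a \<subseteq> W n \<longrightarrow> g a \<le> m)"
proof (rule ccontr)
  assume "\<not> ?thesis"
  then have unbounded: "\<exists>a. \<psi> a \<subseteq> W n \<and> g a > m" if "K \<subseteq> W n" for n m
    using that by (auto simp: not_le)
  have "\<exists>a. g a > n \<and> (\<forall>i\<le>n. K \<subseteq> W i \<longrightarrow> \<psi> a \<subseteq> W i)" for n
  proof -
    \<comment> \<open>Inserting \<open>topspace X\<close> keeps the intersection open even if no
      \<open>W i\<close> with \<open>i \<le> n\<close> contains \<open>K\<close>.\<close>
    let ?U = "\<Inter>(insert (topspace X) (W ` {i. i \<le> n \<and> K \<subseteq> W i}))"
    have U: "openin X ?U"
      using W by (intro openin_Inter) auto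
    have "K \<subseteq> ?U"
      using compactin_subset_topspace[OF K] by auto
    from nbhd[OF U this] obtain j where j: "K \<subseteq> W j" "W j \<subseteq> ?U"
      by (elim exE conjE)
    obtain a where a: "\<psi> a \<subseteq> W j" "g a > n"
      using unbounded[OF j(1), of n] by (elim exE conjE)
    have "\<psi> a \<subseteq> W i" if "i \<le> n" "K \<subseteq> W i" for i
    proof -
      have "?U \<subseteq> W i"
        using that by (intro Inter_lower) simp
      with a(1) j(2) show ?thesis
        by (meson subset_trans)
    qed
    with a(2) show ?thesis
      by auto
  qed
  then obtain a where a: "\<And>n. g (a n) > n" "\<And>n i. i \<le> n \<Longrightarrow> K \<subseteq> W i \<Longrightarrow> \<psi> (a n) \<subseteq> W i"
    by metis
  have "compactin X (K \<union> (\<Union>n. \<psi> (a n)))"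
  proof (rule compactin_Un_UN_shrinking[OF K \<psi>])
    fix U assume "openin X U" "K \<subseteq> U"
    then obtain i where "K \<subseteq> W i" "W i \<subseteq> U"
      using nbhd by blast
    then show "eventually (\<lambda>n. \<psi> (a n) \<subseteq> U) sequentially"
      using a(2) unfolding eventually_sequentially by (intro exI[of _ i]) blast
  qed
  then obtain m where "\<And>b. \<psi> b \<subseteq> K \<union> (\<Union>n. \<psi> (a n)) \<Longrightarrow> g b \<le> m"
    using bounded by blast
  then have "g (a m) \<le> m"
    by blast
  with a(1)[of m] show False
    by simp
qed

lemma no_countable_cover_by_bounded_rectangles:
  fixes e :: "omega1 \<Rightarrow> omega1 \<Rightarrow> nat" and A B :: "'i \<Rightarrow> omega1 set"
  assumes I: "countable I" and e: "\<And>\<alpha>. inj_on (e \<alpha>) {..<\<alpha>}"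
    and bound: "\<And>i \<alpha> \<beta>. i \<in> I \<Longrightarrow> \<alpha> \<in> A i \<Longrightarrow> \<beta> \<in> B i \<Longrightarrow> \<beta> < \<alpha> \<Longrightarrow> e \<alpha> \<beta> \<le> m i"
  shows "(\<Union>i\<in>I. A i \<times> B i) \<noteq> UNIV"
proof
  assume cover: "(\<Union>i\<in>I. A i \<times> B i) = UNIV"
  have finite: "finite (B i)" if i: "i \<in> I" "uncountable (A i)" for i
  proof (rule ccontr)
    assume "infinite (B i)"
    then obtain C where C: "countable C" "infinite C" "C \<subseteq> B i"
      using infinite_countable_subset'[of "B i"] by blast
    have "{..\<gamma>} = insert \<gamma> {..<\<gamma>}" for \<gamma> :: omega1
      by auto
    then have "countable {..\<gamma>}" for \<gamma> :: omega1
      using countable_lessThan_omega1 by simp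
    then have "countable (\<Union>\<gamma>\<in>C. {..\<gamma>})"
      using C(1) by (intro countable_UN) auto
    \<comment> \<open>An uncountable \<open>A i\<close> has an element \<alpha> above all of the
      countable set \<open>C\<close>; then \<open>e \<alpha>\<close> would embed the infinite
      \<open>C\<close> into \<open>{..m i}\<close>.\<close>
    then have "\<not> A i \<subseteq> (\<Union>\<gamma>\<in>C. {..\<gamma>})"
      using i(2) countable_subset by metis
    then obtain \<alpha> where \<alpha>: "\<alpha> \<in> A i" "\<alpha> \<notin> (\<Union>\<gamma>\<in>C. {..\<gamma>})"
      by (meson subsetI)
    then have below: "C \<subseteq> {..<\<alpha>}"
      by auto
    then have "e \<alpha> ` C \<subseteq> {..m i}"
      using bound[OF i(1) \<alpha>(1)] C(3) by auto
    then have "finite (e \<alpha> ` C)"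
      by (rule finite_subset) simp
    then show False
      using C(2) finite_imageD inj_on_subset[OF e below] by blast
  qed
  \<comment> \<open>Choose \<beta> outside every \<open>B i\<close> with \<open>A i\<close>
    uncountable, and \<alpha> outside every countable \<open>A i\<close>: no rectangle contains the
    pair.\<close>
  have "countable (\<Union>i\<in>{i \<in> I. uncountable (A i)}. B i)"
    using I finite by (intro countable_UN) (auto intro: countable_finite)
  then obtain \<beta> where \<beta>: "\<beta> \<notin> (\<Union>i\<in>{i \<in> I. uncountable (A i)}. B i)"
    using uncountable_omega1 by (metis UNIV_I countable_subset subsetI)
  have "countable (\<Union>i\<in>{i \<in> I. countable (A i)}. A i)"
    using I by (intro countable_UN) auto
  then obtain \<alpha> where \<alpha>: "\<alpha> \<notin> (\<Union>i\<in>{i \<in> I. countable (A i)}. A i)"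
    using uncountable_omega1 by (metis UNIV_I countable_subset subsetI)
  have "(\<alpha>, \<beta>) \<in> (\<Union>i\<in>I. A i \<times> B i)"
    by (simp add: cover)
  with \<alpha> \<beta> show False
    by blast
qed

theorem proposition30:
  fixes M :: "'a topology"
  assumes "metrizable_space M" and "separable_space M"
  shows "\<not> compact_subsets M \<ge>\<^sub>T Sigma_omega1"
proof
  assume "compact_subsets M \<ge>\<^sub>T Sigma_omega1"
  then obtain \<psi> \<phi> where \<psi>: "\<And>f. f \<in> Sigma_omega1 \<Longrightarrow> compactin M (\<psi> f)"
    and \<phi>: "\<And>f L. f \<in> Sigma_omega1 \<Longrightarrow> compactin M L \<Longrightarrow> \<psi> f \<subseteq> L \<Longrightarrow> f \<le> \<phi> L"
    by (rule tukey_ge_imp_bounded_preimages) (auto simp: compact_subsets_def)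
  have "second_countable M"
    using assms by (rule separable_metrizable_imp_second_countable)
  then obtain W :: "nat \<Rightarrow> 'a set" where W: "\<And>n. openin M (W n)"
    and nbhd: "\<And>K U. compactin M K \<Longrightarrow> openin M U \<Longrightarrow> K \<subseteq> U \<Longrightarrow> \<exists>n. K \<subseteq> W n \<and> W n \<subseteq> U"
    by (rule second_countable_compact_neighbourhoods) blast
  define e where "e \<alpha> = to_nat_on {..<\<alpha>}" for \<alpha> :: omega1
  define f where "f \<alpha> \<beta> = (if \<beta> < \<alpha> then e \<alpha> \<beta> else 0)" for \<alpha> \<beta> :: omega1
  have f: "f \<alpha> \<in> Sigma_omega1" for \<alpha>
    unfolding Sigma_omega1_def f_def by (intro CollectI exI[of _ \<alpha>]) auto
  \<comment> \<open>In an index \<open>(n, m)\<close>, \<open>n\<close> selects the open set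
    \<open>W n\<close> and \<open>m\<close> is the bound on the rectangle.\<close>
  define A where "A = (\<lambda>(n, m::nat). {\<alpha>. \<psi> (f \<alpha>) \<subseteq> W n})"
  define B where "B = (\<lambda>(n, m). {\<beta>. \<forall>\<alpha>. \<psi> (f \<alpha>) \<subseteq> W n \<longrightarrow> f \<alpha> \<beta> \<le> m})"
  have "(\<Union>i\<in>UNIV. A i \<times> B i) \<noteq> UNIV"
  proof (rule no_countable_cover_by_bounded_rectangles)
    show "inj_on (e \<alpha>) {..<\<alpha>}" for \<alpha>
      unfolding e_def by (rule inj_on_to_nat_on[OF countable_lessThan_omega1])
    show "e \<alpha> \<beta> \<le> snd i" if "\<alpha> \<in> A i" "\<beta> \<in> B i" "\<beta> < \<alpha>" for i \<alpha> \<beta>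
      using that by (cases i) (auto simp: A_def B_def f_def)
  qed simp
  moreover have "(\<alpha>, \<beta>) \<in> (\<Union>i\<in>UNIV. A i \<times> B i)" for \<alpha> \<beta>
  proof -
    \<comment> \<open>Local boundedness is used at the compact set
      \<open>\<psi> (f \<alpha>)\<close>, for the coordinate \<beta>; on the subsets of a compact
      \<open>L\<close> the bound is \<open>\<phi> L \<beta>\<close>.\<close>
    have "\<exists>n m. \<psi> (f \<alpha>) \<subseteq> W n \<and> (\<forall>\<gamma>. \<psi> (f \<gamma>) \<subseteq> W n \<longrightarrow> f \<gamma> \<beta> \<le> m)"
    proof (rule locally_bounded_at_compact[where X = M and \<psi> = "\<lambda>\<gamma>. \<psi> (f \<gamma>)"])
      show "\<exists>m. \<forall>\<gamma>. \<psi> (f \<gamma>) \<subseteq> L \<longrightarrow> f \<gamma> \<beta> \<le> m" if "compactin M L" for L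
        using \<phi>[OF f that] by (auto simp: le_fun_def)
    qed (use W nbhd \<psi> f in auto)
    then obtain n m where "(\<alpha>, \<beta>) \<in> A (n, m) \<times> B (n, m)"
      by (auto simp: A_def B_def)
    then show ?thesis
      by blast
  qed
  ultimately show False
    by auto
qed

end
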